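(* Let $A$ be a finite-dimensional nilpotent Leibniz algebra over a field $\mathbb{F}$ that satisfies P2 and has coclass $1$. Then one of the following holds: (1) $A$ is a Lie algebra, and $A$ is abelian of dimension $2$ or $A$ is the Heisenberg Lie algebra of dimension $3$. (2) $A=Z_2(A)$ and $\dim(A)=3$, and $A$ has a basis $x,y,z$ with multiplication $[x,x]=z$, $[y,y]=\tau z$, $[x,y]=\lambda z$, $[y,x]=\varepsilon z$ (all other products of basis elements being zero), where $\tau,\lambda,\varepsilon\in\mathbb{F}$, $\tau\neq 0$ and $(\lambda+\varepsilon)^2-4\tau$ is not a square in $\mathbb{F}$.
   Context: A (left) Leibniz algebra over a field $\mathbb{F}$ is an $\mathbb{F}$-vector space $A$ with a bilinear map $[\,,]:A\times A\to A$ satisfying $[a,[b,c]]=[[a,b],c]+[b,[a,c]]$ for all $a,b,c$. Lower central series: $A^1=A$, $A^{i+1}=[A,A^i]$. $A$ is nilpotent of class $c=cl(A)$ if $A^{c+1}=0$ and $A^c\ne 0$. The coclass is $cc(A)=\dim(A)-cl(A)$. The center $Z(A)$ is the set of $z$ with $[z,A]=[A,z]=0$; the upper central series is $Z_0(A)=0$, $Z_i(A)/Z_{i-1}(A)=Z(A/Z_{i-1}(A))$. $A$ is a Lie algebra if $[a,a]=0$ for all $a$. Property P2: for maximal subalgebras $M$ of $A$, $\dim(Z_i(M))$ depends only on $i$ and not on $M$ (where $Z_i(M)$ is the $i$th term of the upper central series of $M$).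
   Formalization: In characteristic 2 the printed claim fails (over F_2: [x,x]=[y,y]=[x,y]=z, [y,x]=0), as (λ+ε)²−4τ is then always a square; there the last condition of (2) is replaced by: t²−(λ+ε)t+τ has no root in F. In other characteristics it is as printed. *)

theory Defs
  imports Complex_Main
begin

text \<open>Left Leibniz algebras. The carrier is the whole type \<open>'a\<close>; subalgebras are sets.\<close>

locale leibniz_algebra = vector_space scale
  for scale :: "'f::field \<Rightarrow> 'a::ab_group_add \<Rightarrow> 'a" +
  fixes br :: "'a \<Rightarrow> 'a \<Rightarrow> 'a"
  assumes linear_right: "Vector_Spaces.linear scale scale (\<lambda>b. br a b)"
    and linear_left: "Vector_Spaces.linear scale scale (\<lambda>a. br a b)"
    and leibniz: "br a (br b c) = br (br a b) c + br b (br a c)"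
begin

definition product :: "'a set \<Rightarrow> 'a set \<Rightarrow> 'a set" where
  "product S T = span {br s t |s t. s \<in> S \<and> t \<in> T}"

text \<open>The lower central series starts at \<open>lcs 1 = UNIV\<close>; the value at \<open>0\<close> is a dummy.\<close>

fun lcs :: "nat \<Rightarrow> 'a set" where
  "lcs 0 = UNIV"
| "lcs (Suc 0) = UNIV"
| "lcs (Suc (Suc i)) = product UNIV (lcs (Suc i))"

definition nilpotent :: bool where
  "nilpotent \<longleftrightarrow> (\<exists>i\<ge>1. lcs i = {0})"

definition nilpotent_of_class :: "nat \<Rightarrow> bool" where
  "nilpotent_of_class c \<longleftrightarrow> c \<ge> 1 \<and> lcs (c + 1) = {0} \<and> lcs c \<noteq> {0}"

definition cl :: nat where
  "cl = (THE c. nilpotent_of_class c)"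

definition cc :: int where
  "cc = int (dim (UNIV :: 'a set)) - int cl"

definition subalgebra :: "'a set \<Rightarrow> bool" where
  "subalgebra S \<longleftrightarrow> subspace S \<and> (\<forall>a\<in>S. \<forall>b\<in>S. br a b \<in> S)"

definition maximal_subalgebra :: "'a set \<Rightarrow> bool" where
  "maximal_subalgebra M \<longleftrightarrow> subalgebra M \<and> M \<noteq> UNIV \<and>
     (\<forall>S. subalgebra S \<longrightarrow> M \<subseteq> S \<longrightarrow> S = M \<or> S = UNIV)"

text \<open>\<open>ucs M i\<close> is \<open>Z\<^sub>i(M)\<close> for a subalgebra \<open>M\<close>. Instead of forming the quotient, the
  step takes the preimage in \<open>M\<close> of the center of \<open>M / Z\<^sub>i(M)\<close>; for \<open>i = 0\<close> this is \<open>Z(M)\<close>.\<close>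

primrec ucs :: "'a set \<Rightarrow> nat \<Rightarrow> 'a set" where
  "ucs M 0 = {0}"
| "ucs M (Suc i) = {z \<in> M. \<forall>m\<in>M. br z m \<in> ucs M i \<and> br m z \<in> ucs M i}"

definition P2 :: bool where
  "P2 \<longleftrightarrow> (\<forall>i M N. maximal_subalgebra M \<longrightarrow> maximal_subalgebra N \<longrightarrow>
     dim (ucs M i) = dim (ucs N i))"

definition is_Lie :: bool where
  "is_Lie \<longleftrightarrow> (\<forall>a. br a a = 0)"

definition abelian :: bool where
  "abelian \<longleftrightarrow> (\<forall>a b. br a b = 0)"

definition basis3 :: "'a \<Rightarrow> 'a \<Rightarrow> 'a \<Rightarrow> bool" where
  "basis3 x y z \<longleftrightarrow> distinct [x, y, z] \<and> independent {x, y, z} \<and> span {x, y, z} = UNIV"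

text \<open>The three-dimensional Heisenberg Lie algebra; the remaining products follow from
  \<open>[a,a] = 0\<close>.\<close>

definition Heisenberg3 :: bool where
  "Heisenberg3 \<longleftrightarrow> is_Lie \<and>
     (\<exists>x y z. basis3 x y z \<and> br x y = z \<and> br x z = 0 \<and> br y z = 0)"

end

end

theory Submission
  imports Defs
begin

text \<open>Coclass 1 forces the factors of the lower central series to have dimensions
  \<open>2, 1, \<dots>, 1\<close>, so for every \<open>u\<close> outside \<open>A\<^sup>2\<close> the span of \<open>u\<close> and \<open>A\<^sup>2\<close> is a maximal subalgebra
  \<open>M\<^sub>u\<close>, whose \<open>i\<close>-th center contains \<open>A\<^sup>c\<^sup>+\<^sup>1\<^sup>-\<^sup>i\<close> for \<open>i < c\<close>, where \<open>c\<close> is the class of \<open>A\<close>.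
  For each \<open>i \<le> c - 2\<close> equality holds for some \<open>u\<close>, hence
  by P2 for all \<open>u\<close>, so that always \<open>Z\<^sub>c\<^sub>-\<^sub>2(M\<^sub>u) = A\<^sup>3\<close>. But if \<open>c \<ge> 3\<close>, some \<open>u\<close> outside \<open>A\<^sup>2\<close> acts
  trivially from both sides on \<open>A\<^sup>2/A\<^sup>4\<close>, and then \<open>Z\<^sub>c\<^sub>-\<^sub>2(M\<^sub>u)\<close> contains \<open>A\<^sup>2\<close>. So \<open>c \<le> 2\<close>.
  For \<open>c = 2\<close> the product is a bilinear form on the plane \<open>A/A\<^sup>2\<close>, and \<open>M\<^sub>u\<close> is abelian iff \<open>u\<close> is
  isotropic; by P2 the form is either alternating or anisotropic.\<close>

context leibniz_algebra
begin

section \<open>Bilinearity and the Leibniz identity\<close>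

lemma br_add_right: "br a (b + c) = br a b + br a c"
  and br_scale_right: "br a (scale k b) = scale k (br a b)"
  and br_diff_right: "br a (b - c) = br a b - br a c"
  and br_zero_right [simp]: "br a 0 = 0"
proof -
  interpret l: Vector_Spaces.linear scale scale "\<lambda>b. br a b" by (rule linear_right)
  show "br a (b + c) = br a b + br a c" "br a (scale k b) = scale k (br a b)"
    "br a (b - c) = br a b - br a c" "br a 0 = 0"
    by (rule l.add l.scale l.diff l.zero)+
qed

lemma br_add_left: "br (a + b) c = br a c + br b c"
  and br_scale_left: "br (scale k a) c = scale k (br a c)"
  and br_diff_left: "br (a - b) c = br a c - br b c"
  and br_zero_left [simp]: "br 0 c = 0"
proof -
  interpret l: Vector_Spaces.linear scale scale "\<lambda>a. br a c" by (rule linear_left)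
  show "br (a + b) c = br a c + br b c" "br (scale k a) c = scale k (br a c)"
    "br (a - b) c = br a c - br b c" "br 0 c = 0"
    by (rule l.add l.scale l.diff l.zero)+
qed

lemmas br_linear = br_add_left br_add_right br_scale_left br_scale_right

lemma leibniz_left: "br (br a b) c = br a (br b c) - br b (br a c)"
  using leibniz[of a b c] by simp

lemma br_square_left: "br (br a a) c = 0"
  by (simp add: leibniz_left)

text \<open>Fixing either factor, the preimage of \<open>W\<close> is a subspace, so generators
  suffice in each argument in turn.\<close>

lemma br_in_subspace:
  assumes "s \<in> span S" "t \<in> span T" "subspace W" "\<And>s t. s \<in> S \<Longrightarrow> t \<in> T \<Longrightarrow> br s t \<in> W"
  shows "br s t \<in> W"
proof -
  have "subspace {t. br s t \<in> W}" for s
    using assms(3) by (auto simp: subspace_def br_linear)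
  then have *: "br s t \<in> W" if "s \<in> S" for s
    using span_minimal[of T "{t. br s t \<in> W}"] assms(2,4) that by auto
  have "subspace {s. br s t \<in> W}"
    using assms(3) by (auto simp: subspace_def br_linear)
  then show ?thesis
    using span_minimal[of S "{s. br s t \<in> W}"] assms(1) * by auto
qed

text \<open>Indices are shifted so that the recursion is uniform and bracketing adds them up to 1:
  \<open>D i\<close> is the paper's \<open>A\<^sup>i\<^sup>+\<^sup>1\<close>.\<close>

abbreviation D :: "nat \<Rightarrow> 'a set" where
  "D i \<equiv> lcs (Suc i)"

section \<open>The lower central series and the nilpotency class\<close>

lemma subspace_D: "subspace (D i)"
  by (cases i) (auto simp: product_def)

lemma span_D [simp]: "span (D i) = D i"
  using subspace_D by simp

lemma br_D_Suc: "b \<in> D i \<Longrightarrow> br a b \<in> D (Suc i)"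
  by (auto simp: product_def intro: span_base)

lemma D_Suc_subset:
  assumes "subspace W" "\<And>a b. b \<in> D i \<Longrightarrow> br a b \<in> W"
  shows "D (Suc i) \<subseteq> W"
  unfolding lcs.simps(3) product_def
  by (rule span_minimal) (use assms in auto)

lemma D_Suc_le: "D (Suc i) \<subseteq> D i"
proof (induction i)
  case (Suc i)
  show ?case
    by (rule D_Suc_subset[OF subspace_D]) (use Suc br_D_Suc in blast)
qed simp

lemma D_antimono: "i \<le> j \<Longrightarrow> D j \<subseteq> D i"
  by (induction j rule: dec_induct) (use D_Suc_le in blast)+

text \<open>Left multiplication by \<open>br a b\<close> is the commutator of those by
  \<open>a\<close> and \<open>b\<close>, so the level of a left factor is built up from nested left
  multiplications.\<close>

lemma br_D: "s \<in> D i \<Longrightarrow> t \<in> D j \<Longrightarrow> br s t \<in> D (Suc (i + j))"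
proof (induction i arbitrary: s t j)
  case 0
  then show ?case using br_D_Suc by simp
next
  case (Suc i)
  show ?case
  proof (rule br_in_subspace[OF _ _ subspace_D])
    show "s \<in> span {br a b |a b. b \<in> D i}" using Suc.prems(1) by (simp add: product_def)
    show "t \<in> span (D j)" using Suc.prems(2) by simp
    fix s' t' assume "s' \<in> {br a b |a b. b \<in> D i}" and t': "t' \<in> D j"
    then obtain a b where ab: "s' = br a b" "b \<in> D i" by auto
    have "br a (br b t') \<in> D (Suc (Suc (i + j)))"
      using Suc.IH[OF ab(2) t'] by (rule br_D_Suc)
    moreover have "br b (br a t') \<in> D (Suc (i + Suc j))"
      by (rule Suc.IH[OF ab(2) br_D_Suc[OF t']])
    ultimately show "br s' t' \<in> D (Suc (Suc i + j))"
      using subspace_diff[OF subspace_D] by (simp add: ab(1) leibniz_left del: lcs.simps)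
  qed
qed

lemma br_D_right: "s \<in> D i \<Longrightarrow> br s t \<in> D (Suc i)"
  using br_D[of s i t 0] by simp

declare lcs.simps(3) [simp del]

lemma nilpotent_of_class_iff: "nilpotent_of_class c \<longleftrightarrow> c \<ge> 1 \<and> D c = {0} \<and> D (c - 1) \<noteq> {0}"
  by (cases c) (auto simp: nilpotent_of_class_def)

lemma nilpotent_of_class_unique:
  assumes "nilpotent_of_class c" "nilpotent_of_class d"
  shows "c = d"
proof -
  have "\<not> c < d" if "nilpotent_of_class c" "nilpotent_of_class d" for c d
  proof
    assume "c < d"
    then have "D (d - 1) \<subseteq> D c" by (intro D_antimono) simp
    then show False
      using that subspace_0[OF subspace_D, of "d - 1"] by (auto simp: nilpotent_of_class_iff)
  qed
  then show ?thesis using assms by (meson linorder_neqE_nat)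
qed

lemma nilpotent_of_class_cl:
  assumes "nilpotent" "(UNIV :: 'a set) \<noteq> {0}"
  shows "nilpotent_of_class cl"
proof -
  obtain i where i: "i \<ge> 1" "lcs i = {0}" using assms(1) by (auto simp: nilpotent_def)
  then have *: "D (i - 1) = {0}" by (cases i) auto
  define c where "c = (LEAST c. D c = {0})"
  have c: "D c = {0}" unfolding c_def using * by (rule LeastI)
  have "c \<noteq> 0" using c assms(2) by (intro notI) simp
  moreover have "D (c - 1) \<noteq> {0}"
    using not_less_Least[of "c - 1" "\<lambda>c. D c = {0}"] \<open>c \<noteq> 0\<close> by (simp add: c_def)
  ultimately have "nilpotent_of_class c"
    using c by (simp add: nilpotent_of_class_iff)
  then show ?thesis
    unfolding cl_def by (rule theI) (rule nilpotent_of_class_unique[OF _ \<open>nilpotent_of_class c\<close>])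
qed

text \<open>If two consecutive terms agree, the series is constant from there on, although
  \<open>D (c - 1)\<close> is nonzero and \<open>D c\<close> is zero.\<close>

lemma D_strict:
  assumes "nilpotent_of_class c" "i < c"
  shows "D (Suc i) \<subset> D i"
proof -
  have "D (Suc i) \<noteq> D i"
  proof
    assume *: "D (Suc i) = D i"
    have "D j = D i" if "i \<le> j" for j
      using that
    proof (induction j rule: dec_induct)
      case (step j)
      then show ?case using * by (simp add: lcs.simps)
    qed simp
    from this[of c] this[of "c - 1"] show False
      using assms by (simp add: nilpotent_of_class_iff)
  qed
  then show ?thesis using D_Suc_le by blast
qed

section \<open>Upper central series of ideals\<close>

lemma subspace_ucs: "subspace M \<Longrightarrow> subspace (ucs M i)"
  by (induction i) (auto simp: subspace_def br_linear)

lemma ucs_subset: "subspace M \<Longrightarrow> ucs M i \<subseteq> M"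
  by (cases i) (auto simp: subspace_0)

text \<open>When \<open>M\<close> is a two-sided ideal, the Leibniz identity moves an outside factor
  \<open>a\<close> onto \<open>m\<close> or past it. Hence the centers of \<open>M\<close> are left
  ideals of the whole algebra, as \<open>left_ideal_descend\<close> requires.\<close>

lemma ucs_left_ideal:
  assumes "\<And>a m. m \<in> M \<Longrightarrow> br a m \<in> M" "\<And>a m. m \<in> M \<Longrightarrow> br m a \<in> M" "subspace M"
  shows "z \<in> ucs M i \<Longrightarrow> br a z \<in> ucs M i"
proof (induction i arbitrary: z)
  case (Suc i)
  note sub = subspace_ucs[OF assms(3), of i]
  have "br m (br a z) \<in> ucs M i" "br (br a z) m \<in> ucs M i" if "m \<in> M" for m
  proof -
    have "br (br m a) z \<in> ucs M i" "br z (br a m) \<in> ucs M i"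
      using Suc.prems assms(1,2) that by auto
    moreover have "br a (br m z) \<in> ucs M i" "br a (br z m) \<in> ucs M i"
      using Suc that by auto
    ultimately show "br m (br a z) \<in> ucs M i" "br (br a z) m \<in> ucs M i"
      using sub by (simp_all add: leibniz[of m] leibniz_left[of a z] subspace_add subspace_diff)
  qed
  then show ?case using Suc.prems assms(1) by simp
qed simp

abbreviation M :: "'a \<Rightarrow> 'a set" where
  "M u \<equiv> span (insert u (D 1))"

lemma D1_subset_M: "D 1 \<subseteq> M u"
  using span_superset[of "insert u (D 1)"] by auto

lemma br_in_M: "br a b \<in> M u"
  using D1_subset_M br_D_Suc[of b 0 a] by auto

lemma M_cases:
  assumes "z \<in> M u"
  obtains k w where "w \<in> D 1" "z = scale k u + w"
proof -
  obtain k where "z - scale k u \<in> D 1"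
    using assms by (auto simp: span_breakdown_eq simp del: lcs.simps)
  then show ?thesis by (rule that[where k = k]) simp
qed

text \<open>Each bracket goes one level down. The bound \<open>i < c\<close> keeps
  \<open>D (c - i)\<close> inside \<open>D 1\<close>, hence inside \<open>M u\<close>.\<close>

lemma D_subset_ucs:
  assumes "D c = {0}" "i < c"
  shows "D (c - i) \<subseteq> ucs (M u) i"
  using assms(2)
proof (induction i)
  case 0
  then show ?case using assms by simp
next
  case (Suc i)
  then have ci: "c - i = Suc (c - Suc i)" by simp
  show ?case
  proof
    fix z assume z: "z \<in> D (c - Suc i)"
    have "D (c - Suc i) \<subseteq> D 1" using Suc.prems by (intro D_antimono) simp
    then have "z \<in> M u" using z D1_subset_M by blast
    moreover have "br z m \<in> D (c - i)" "br m z \<in> D (c - i)" for m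
      unfolding ci using z by (auto intro: br_D_right br_D_Suc)
    ultimately show "z \<in> ucs (M u) (Suc i)" using Suc by auto
  qed
qed

end

section \<open>Dimension count in coclass 1\<close>

locale fd_leibniz_algebra =
  leibniz_algebra scale br + finite_dimensional_vector_space scale B
  for scale :: "'f::field \<Rightarrow> 'a::ab_group_add \<Rightarrow> 'a"
    and br :: "'a \<Rightarrow> 'a \<Rightarrow> 'a" and B :: "'a set"
begin

declare dim_UNIV [simp del]

lemma subspace_codim1_eq:
  assumes "subspace V" "subspace W" "W \<subseteq> V" "dim V \<le> Suc (dim W)" "z \<in> V" "z \<notin> W"
  shows "V = span (insert z W)"
proof (rule subspace_dim_equal[symmetric])
  show "span (insert z W) \<subseteq> V" using assms by (intro span_minimal) auto
  have "span W = W" using assms(2) by (simp only: span_eq_iff)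
  with assms(6) have "dim (span (insert z W)) = Suc (dim W)"
    by (simp only: dim_span dim_insert if_False not_False_eq_True Suc_eq_plus1)
  then show "dim V \<le> dim (span (insert z W))" using assms by simp
qed (use assms(1) in simp_all)

lemma dim_psubset: "subspace V \<Longrightarrow> subspace W \<Longrightarrow> W \<subset> V \<Longrightarrow> dim W < dim V"
  by (rule ccontr) (use subspace_dim_equal[of W V] in auto)

context
  fixes c
  assumes cls: "nilpotent_of_class c" and dim_carrier: "dim (UNIV :: 'a set) = c + 1"
begin

lemma c_pos: "c \<ge> 1" and D_c: "D c = {0}"
  using cls by (auto simp: nilpotent_of_class_iff)

lemma dim_D_Suc_less: "i < c \<Longrightarrow> dim (D (Suc i)) < dim (D i)"
  by (intro dim_psubset D_strict[OF cls] subspace_D)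

lemma dim_D_ge: "i \<le> c \<Longrightarrow> dim (D i) \<ge> c - i"
proof (induction i rule: inc_induct)
  case (step i)
  then show ?case using dim_D_Suc_less[of i] by simp
qed simp

text \<open>If the codimension of \<open>D 1\<close> were 1, a single element would generate the algebra and all
  factors of the lower central series would have dimension at most 1.\<close>

lemma dim_D1: "dim (D 1) = c - 1"
proof (rule ccontr)
  assume neq: "dim (D 1) \<noteq> c - 1"
  have "dim (D 1) < c + 1" using dim_D_Suc_less[of 0] c_pos dim_carrier by simp
  with neq dim_D_ge[of 1] c_pos have d1: "dim (D 1) = c" by simp
  obtain x where "x \<notin> D 1" using D_strict[OF cls, of 0] c_pos by auto
  then have x: "UNIV = span (insert x (D 1))"
    by (intro subspace_codim1_eq subspace_D) (use d1 dim_carrier in auto)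
  have gen: "\<exists>y\<in>D i. D i \<subseteq> span (insert y (D (Suc i)))" for i
  proof (induction i)
    case 0
    then show ?case using x by auto
  next
    case (Suc i)
    then obtain y where y: "y \<in> D i" "D i \<subseteq> span (insert y (D (Suc i)))" ..
    \<comment> \<open>Among the products of generators only \<open>br x y\<close> can lie outside
      \<open>D (Suc (Suc i))\<close>; it is the next generator.\<close>
    let ?W = "span (insert (br x y) (D (Suc (Suc i))))"
    have *: "br s t \<in> ?W" if "s \<in> insert x (D 1)" "t \<in> insert y (D (Suc i))" for s t
    proof -
      have "t \<in> D i" using that(2) y(1) D_Suc_le by auto
      from that consider "s = x" "t = y" | "t \<in> D (Suc i)" | "s \<in> D 1" by blast
      then show ?thesis
      proof cases
        case 1
        then show ?thesis by (simp add: span_base)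
      next
        case 2
        from br_D_Suc[OF this] show ?thesis by (simp add: span_base)
      next
        case 3
        from br_D[OF this \<open>t \<in> D i\<close>] show ?thesis by (simp add: span_base)
      qed
    qed
    show ?case
    proof (intro bexI D_Suc_subset subspace_span)
      show "br x y \<in> D (Suc i)" by (rule br_D_Suc[OF y(1)])
      show "br a b \<in> ?W" if "b \<in> D i" for a b
        by (rule br_in_subspace[of a "insert x (D 1)" b "insert y (D (Suc i))", OF _ _ subspace_span *]) (use x y that in blast)+
    qed
  qed
  have "dim (D i) \<le> c - i" if "i \<le> c" for i
    using that
  proof (induction i rule: inc_induct)
    case base
    then show ?case using D_c by simp
  next
    case (step i)
    obtain y where "D i \<subseteq> span (insert y (D (Suc i)))" using gen by blast
    then have "dim (D i) \<le> dim (insert y (D (Suc i)))"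
      by (rule dim_mono)
    also have "\<dots> \<le> Suc (dim (D (Suc i)))" by (simp add: dim_insert)
    finally show ?case using step by simp
  qed
  from this[of 0] show False using dim_carrier by simp
qed

text \<open>Strict descent starting from \<open>dim_D1\<close> gives the upper bound,
  \<open>dim_D_ge\<close> the lower one.\<close>

lemma dim_D: "1 \<le> i \<Longrightarrow> i \<le> c \<Longrightarrow> dim (D i) = c - i"
proof (induction i rule: dec_induct)
  case base
  then show ?case using dim_D1 by simp
next
  case (step i)
  then show ?case using dim_D_Suc_less[of i] dim_D_ge[of "Suc i"] by simp
qed

lemma D_eq_span:
  assumes "1 \<le> i" "i < c" "z \<in> D i" "z \<notin> D (Suc i)"
  shows "D i = span (insert z (D (Suc i)))"
proof (rule subspace_codim1_eq)
  show "dim (D i) \<le> Suc (dim (D (Suc i)))" using assms(1,2) dim_D[of i] dim_D[of "Suc i"] by simp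
qed (use assms in \<open>auto intro: subspace_D D_Suc_le[THEN subsetD]\<close>)

section \<open>The maximal subalgebras \<open>M u\<close>\<close>

lemma dim_M:
  assumes "u \<notin> D 1"
  shows "dim (M u) = c"
proof -
  have "u \<notin> span (D 1)" using assms by (simp only: span_D not_False_eq_True)
  then have "dim (insert u (D 1)) = dim (D 1) + 1" by (simp only: dim_insert if_False)
  then show ?thesis using dim_D1 c_pos by (simp only: dim_span)
qed

lemma M_neq_UNIV: "u \<notin> D 1 \<Longrightarrow> M u \<noteq> UNIV"
  using dim_M[of u] dim_carrier by (metis Suc_eq_plus1 n_not_Suc_n)

lemma UNIV_eq_span_insert_M:
  assumes "u \<notin> D 1" "v \<notin> M u"
  shows "UNIV = span (insert v (insert u (D 1)))"
proof -
  have "UNIV = span (insert v (M u))"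
    by (rule subspace_codim1_eq) (use assms dim_M[of u] dim_carrier in auto)
  also have "\<dots> \<subseteq> span (insert v (insert u (D 1)))"
    by (rule span_minimal) (auto intro: span_base span_mono[THEN subsetD, rotated])
  finally show ?thesis by blast
qed

lemma M_maximal:
  assumes u: "u \<notin> D 1"
  shows "maximal_subalgebra (M u)"
  unfolding maximal_subalgebra_def subalgebra_def
proof (intro conjI allI impI ballI)
  fix S assume S: "subspace S \<and> (\<forall>a\<in>S. \<forall>b\<in>S. br a b \<in> S)" "M u \<subseteq> S"
  show "S = M u \<or> S = UNIV"
  proof (rule disjCI)
    assume "S \<noteq> UNIV"
    show "S = M u"
    proof (rule ccontr)
      assume "S \<noteq> M u"
      then obtain z where z: "z \<in> S" "z \<notin> M u" using S(2) by blast
      have "insert z (insert u (D 1)) \<subseteq> S"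
        using z S(2) span_superset[of "insert u (D 1)"] by blast
      then have "span (insert z (insert u (D 1))) \<subseteq> S" using S(1) span_minimal by blast
      then show False using UNIV_eq_span_insert_M[OF u z(2)] \<open>S \<noteq> UNIV\<close> by blast
    qed
  qed
qed (use M_neq_UNIV[OF u] br_in_M in \<open>auto simp del: lcs.simps\<close>)

text \<open>Ideals meeting a factor of the lower central series meet all later ones, since each
  later factor is one-dimensional and generated by left multiplications.\<close>

lemma left_ideal_descend:
  assumes ideal: "\<And>a z. z \<in> S \<Longrightarrow> br a z \<in> S"
    and z: "z \<in> S" "z \<in> D k" "z \<notin> D (Suc k)" and k: "1 \<le> k" "k \<le> m" "m < c"
  shows "\<exists>z'\<in>S. z' \<in> D m \<and> z' \<notin> D (Suc m)"
  using k(2,3)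
proof (induction m rule: dec_induct)
  case base
  then show ?case using z by blast
next
  case (step m)
  then obtain z' where z': "z' \<in> S" "z' \<in> D m" "z' \<notin> D (Suc m)" by auto
  have span: "D m = span (insert z' (D (Suc m)))"
    by (rule D_eq_span) (use step z' k in auto)
  \<comment> \<open>If every left multiplication took \<open>z'\<close> two levels down, the same
    would hold on all of \<open>D m\<close>, which \<open>z'\<close> spans modulo
    \<open>D (Suc m)\<close>, and the series would stall.\<close>
  have "\<exists>a. br a z' \<notin> D (Suc (Suc m))"
  proof (rule ccontr)
    assume *: "\<not> ?thesis"
    have "D (Suc m) \<subseteq> D (Suc (Suc m))"
    proof (rule D_Suc_subset[OF subspace_D])
      fix a b assume "b \<in> D m"
      then show "br a b \<in> D (Suc (Suc m))"
        by (intro br_in_subspace[of a UNIV b "insert z' (D (Suc m))"] subspace_D)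
          (use * span br_D_Suc in auto)
    qed
    then show False using D_strict[OF cls step.prems] by blast
  qed
  then show ?case using z' ideal br_D_Suc by blast
qed

section \<open>Centers of the maximal subalgebras under P2\<close>

lemma D_level:
  assumes "z \<in> D 1" "z \<notin> D (Suc m)"
  obtains k where "1 \<le> k" "k \<le> m" "z \<in> D k" "z \<notin> D (Suc k)"
proof -
  define k where "k = (LEAST k. z \<notin> D (Suc k))"
  have 1: "z \<notin> D (Suc k)" unfolding k_def by (rule LeastI) (rule assms)
  have 2: "k \<le> m" unfolding k_def by (rule Least_le) (rule assms)
  have 3: "k \<noteq> 0" using 1 assms(1) by (intro notI) simp
  then have "z \<in> D (Suc (k - 1))"
    using not_less_Least[of "k - 1" "\<lambda>k. z \<notin> D (Suc k)"] by (auto simp: k_def)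
  with 1 2 3 show ?thesis by (intro that[of k]) auto
qed

text \<open>Since \<open>u\<close> acts nontrivially on \<open>b\<close>, central elements modulo
  \<open>D (Suc (Suc m))\<close> can neither have a \<open>u\<close> component nor lie in
  \<open>D 1\<close> outside \<open>D (Suc m)\<close>.\<close>

lemma ucs_M_Suc_subset:
  assumes b: "b \<in> D m" "br u b \<notin> D (Suc (Suc m))" and m: "1 \<le> m" "m < c"
    and ucs: "ucs (M u) i = D (Suc (Suc m))"
  shows "ucs (M u) (Suc i) \<subseteq> D (Suc m)"
proof
  fix z assume z: "z \<in> ucs (M u) (Suc i)"
  have Dm: "D m \<subseteq> D 1" using m by (intro D_antimono) simp
  have bM: "b \<in> M u" using b(1) Dm D1_subset_M by blast
  have uM: "u \<in> M u" by (simp add: span_base)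
  note sub = subspace_D[of "Suc (Suc m)"]
  have "z \<in> M u" using z by simp
  then obtain k w where w: "w \<in> D 1" and zw: "z = scale k u + w" by (rule M_cases)
  \<comment> \<open>As \<open>w\<close> takes \<open>b\<close> two levels down,
    \<open>br z b\<close> is \<open>scale k (br u b)\<close> modulo \<open>D (Suc (Suc m))\<close>,
    where it vanishes.\<close>
  have "k = 0"
  proof (rule ccontr)
    assume "k \<noteq> 0"
    have "br z b \<in> D (Suc (Suc m))" using z bM ucs by simp
    moreover have "br w b \<in> D (Suc (Suc m))" using br_D[OF w b(1)] by simp
    ultimately have "br z b - br w b \<in> D (Suc (Suc m))" by (rule subspace_diff[OF sub])
    then have "scale k (br u b) \<in> D (Suc (Suc m))" by (simp add: zw br_linear)
    then have "scale (inverse k) (scale k (br u b)) \<in> D (Suc (Suc m))"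
      by (rule subspace_scale[OF sub])
    then show False using \<open>k \<noteq> 0\<close> b(2) by simp
  qed
  then have z1: "z \<in> D 1" using w zw by simp
  show "z \<in> D (Suc m)"
  proof (rule ccontr)
    assume "z \<notin> D (Suc m)"
    from z1 this obtain l where l: "1 \<le> l" "l \<le> m" "z \<in> D l" "z \<notin> D (Suc l)"
      by (rule D_level)
    \<comment> \<open>At level \<open>m\<close>, \<open>b\<close> is a multiple of \<open>z'\<close>
      modulo \<open>D (Suc m)\<close>, so \<open>u\<close> would kill \<open>b\<close> along with
      \<open>z'\<close>.\<close>
    have "\<exists>z'\<in>ucs (M u) (Suc i). z' \<in> D m \<and> z' \<notin> D (Suc m)"
      by (rule left_ideal_descend[OF ucs_left_ideal[OF br_in_M br_in_M subspace_span] z l(3,4,1,2) m(2)])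
    then obtain z' where z': "z' \<in> ucs (M u) (Suc i)" "z' \<in> D m" "z' \<notin> D (Suc m)" by blast
    have "br u z' \<in> D (Suc (Suc m))" using z'(1) uM ucs by simp
    moreover have "b \<in> span (insert z' (D (Suc m)))"
      using D_eq_span[OF m z'(2,3)] b(1) by simp
    ultimately have "br u b \<in> D (Suc (Suc m))"
      by (intro br_in_subspace[of u "{u}" b "insert z' (D (Suc m))"] sub)
        (auto simp: span_base intro: br_D_Suc)
    then show False using b(2) by contradiction
  qed
qed

text \<open>For a suitable \<open>u\<close> the upper central series of \<open>M u\<close> is as small as possible in each step,
  and P2 transfers this to all \<open>u\<close>.\<close>

lemma ucs_M:
  assumes P2
  shows "i + 2 \<le> c \<Longrightarrow> u \<notin> D 1 \<Longrightarrow> ucs (M u) i = D (c - i)"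
proof (induction i arbitrary: u)
  case 0
  then show ?case using D_c by simp
next
  case (Suc i)
  \<comment> \<open>Chosen so that \<open>c - i = m + 2\<close>; the bound on \<open>Suc i\<close>
    then gives \<open>1 \<le> m\<close>.\<close>
  define m where "m = c - i - 2"
  have m: "c - i = Suc (Suc m)" "c - Suc i = Suc m" "1 \<le> m" "m < c" "Suc m < c"
    using Suc.prems by (auto simp: m_def)
  have "\<exists>a b. b \<in> D m \<and> br a b \<notin> D (Suc (Suc m))"
  proof (rule ccontr)
    assume "\<not> ?thesis"
    then have "D (Suc m) \<subseteq> D (Suc (Suc m))" by (intro D_Suc_subset subspace_D) blast
    then show False using D_strict[OF cls m(5)] by blast
  qed
  then obtain a b where ab: "b \<in> D m" "br a b \<notin> D (Suc (Suc m))" by blast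
  have a: "a \<notin> D 1" using br_D[of a 1 b m] ab by auto
  have "ucs (M a) i = D (Suc (Suc m))" using Suc.IH[OF _ a] Suc.prems m by simp
  from ucs_M_Suc_subset[OF ab m(3,4) this]
  have "dim (ucs (M a) (Suc i)) \<le> dim (D (Suc m))" by (rule dim_subset)
  \<comment> \<open>P2 carries the bound from \<open>M a\<close> to every \<open>M u\<close>; the
    inclusion from \<open>D_subset_ucs\<close> becomes an equality by dimension.\<close>
  then have "dim (ucs (M u) (Suc i)) \<le> dim (D (Suc m))"
    using assms M_maximal[OF a] M_maximal[OF Suc.prems(2)] unfolding P2_def by metis
  moreover have "D (Suc m) \<subseteq> ucs (M u) (Suc i)"
    using D_subset_ucs[OF D_c, of "Suc i" u] Suc.prems m by simp
  ultimately show ?case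
    unfolding m(2) by (intro subspace_dim_equal[symmetric] subspace_D subspace_ucs subspace_span)
qed

text \<open>One \<open>u\<close> outside \<open>D 1\<close> kills \<open>D 1\<close> modulo \<open>D 3\<close> from the left. That it also does so from the
  right follows from \<open>[[u,u],_] = 0\<close> if \<open>[u,u]\<close> generates \<open>D 1\<close> modulo \<open>D 2\<close>. Otherwise the Leibniz
  identity reduces the claim for products of generators to \<open>[v,[u,u]]\<close>, which is in \<open>D 3\<close>.\<close>

lemma D1_centralizer:
  assumes "3 \<le> c"
  obtains u where "u \<notin> D 1"
    and "\<And>b. b \<in> D 1 \<Longrightarrow> br u b \<in> D 3" and "\<And>b. b \<in> D 1 \<Longrightarrow> br b u \<in> D 3"
proof -
  note sub = subspace_D[of 3]
  have D2: "br a b \<in> D 2" "br b a \<in> D 2" if "b \<in> D 1" for a b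
    using br_D_Suc[of b 1 a] br_D_right[of b 1 a] that by (simp_all add: numeral_2_eq_2)
  have D3: "br a b \<in> D 3" "br b a \<in> D 3" if "b \<in> D 2" for a b
    using br_D_Suc[of b 2 a] br_D_right[of b 2 a] that by (simp_all only: numeral_3_eq_3 numeral_2_eq_2)
  obtain x where x: "x \<notin> D 1" using D_strict[OF cls, of 0] assms by auto
  obtain y where y: "y \<notin> M x" using M_neq_UNIV[OF x] by blast
  obtain b where b: "b \<in> D 1" "b \<notin> D 2"
    using D_strict[OF cls, of 1] assms by (auto simp del: lcs.simps simp: numeral_2_eq_2)
  have spanb: "D 1 = span (insert b (D 2))"
    using D_eq_span[of 1 b] b assms by (simp only: Suc_1) simp
  obtain u where u: "u \<notin> D 1" "br u b \<in> D 3"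
  proof (cases "br x b \<in> D 3")
    case True
    then show ?thesis using that x by blast
  next
    case False
    \<comment> \<open>Modulo \<open>D 3\<close>, \<open>br x b\<close> spans \<open>D 2\<close>, so
      a scalar \<open>t\<close> cancels \<open>br y b\<close>; \<open>y - scale t x\<close> avoids
      \<open>D 1\<close> because \<open>y\<close> is outside \<open>M x\<close>.\<close>
    have "D 2 = span (insert (br x b) (D 3))"
      using D_eq_span[of 2 "br x b"] D2(1)[OF b(1)] False assms by (simp add: eval_nat_numeral)
    with D2(1)[OF b(1), of y] have "br y b \<in> span (insert (br x b) (D 3))" by simp
    then obtain t where "br y b - scale t (br x b) \<in> D 3"
      unfolding span_breakdown_eq span_D ..
    moreover have "y - scale t x \<notin> D 1"
      using y by (auto simp: span_breakdown_eq)
    ultimately show ?thesis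
      by (intro that[of "y - scale t x"]) (simp_all only: br_diff_left br_scale_left not_False_eq_True)
  qed
  have left: "br u a \<in> D 3" if "a \<in> D 1" for a
    by (rule br_in_subspace[of u "{u}" a "insert b (D 2)", OF _ _ sub])
      (use that u D3 spanb in \<open>auto simp: span_base\<close>)
  have right: "br a u \<in> D 3" if "a \<in> D 1" for a
  proof (cases "br u u \<in> D 2")
    case False
    have "br u u \<in> D 1" using br_D_Suc[of u 0 u] by simp
    then have "D 1 = span (insert (br u u) (D 2))"
      using D_eq_span[of 1 "br u u"] False assms by (simp only: Suc_1) simp
    then show ?thesis
      by (intro br_in_subspace[of a "insert (br u u) (D 2)" u "{u}", OF _ _ sub])
        (use that D3 subspace_0[OF sub] in \<open>auto simp: span_base br_square_left\<close>)
  next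
    case True
    obtain v where v: "v \<notin> M u" using M_neq_UNIV[OF u(1)] by blast
    let ?G = "insert v (insert u (D 1))"
    let ?W = "{w. br w u \<in> D 3}"
    have W: "subspace ?W"
      using sub by (auto simp: subspace_def br_linear)
    \<comment> \<open>Products of members of \<open>?G\<close> suffice: \<open>?G\<close> spans the
      algebra and products span \<open>D 1\<close>.\<close>
    have gen: "br p q \<in> ?W" if "p \<in> ?G" "q \<in> ?G" for p q
    proof -
      have "br v (br u u) \<in> D 3" by (rule D3(1)[OF True])
      moreover have "br u (br v u) \<in> D 3" using left br_D_Suc[of u 0 v] by simp
      ultimately have "br u v \<in> ?W" "br v u \<in> ?W"
        using subspace_diff[OF sub] by (simp_all add: leibniz_left)
      moreover have "br a a \<in> ?W" for a
        using subspace_0[OF sub] by (simp add: br_square_left)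
      moreover have "br p q \<in> ?W" if "p \<in> D 1 \<or> q \<in> D 1"
        using that D2 D3 by blast
      ultimately show ?thesis using that by blast
    qed
    have "D (Suc 0) \<subseteq> ?W"
    proof (rule D_Suc_subset[OF W])
      show "br p q \<in> ?W" for p q
        by (rule br_in_subspace[OF _ _ W gen]) (use UNIV_eq_span_insert_M[OF u(1) v] in auto)
    qed
    then show ?thesis using that by auto
  qed
  show ?thesis by (rule that[OF u(1) left right])
qed

section \<open>The bound on the class and the case of class two\<close>

lemma class_le_2:
  assumes P2
  shows "c \<le> 2"
proof (rule ccontr)
  assume "\<not> c \<le> 2"
  then have c3: "3 \<le> c" by simp
  then obtain u where u: "u \<notin> D 1" and cen: "\<And>b. b \<in> D 1 \<Longrightarrow> br u b \<in> D 3"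
      "\<And>b. b \<in> D 1 \<Longrightarrow> br b u \<in> D 3"
    by (rule D1_centralizer) blast
  note sub = subspace_D[of 3]
  have D11: "br a b \<in> D 3" if "a \<in> D 1" "b \<in> D 1" for a b
    using br_D[OF that] by (simp add: numeral_eq_Suc)
  have 3: "ucs (M u) (c - 3) = D 3" using ucs_M[OF assms, of "c - 3" u] u c3 by simp
  have "D 1 \<subseteq> ucs (M u) (Suc (c - 3))"
  proof
    fix b assume b: "b \<in> D 1"
    have "br b m \<in> D 3 \<and> br m b \<in> D 3" if "m \<in> M u" for m
    proof -
      obtain k w where w: "w \<in> D 1" "m = scale k u + w" using \<open>m \<in> M u\<close> by (rule M_cases)
      then show ?thesis
        using b sub cen D11 by (auto simp: br_linear intro!: subspace_add subspace_scale simp del: lcs.simps)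
    qed
    then show "b \<in> ucs (M u) (Suc (c - 3))" using b D1_subset_M 3 by auto
  qed
  \<comment> \<open>The index is \<open>c - 2\<close>, so P2 forces this center down to
    \<open>D 2\<close>, properly inside \<open>D 1\<close>.\<close>
  moreover have "ucs (M u) (Suc (c - 3)) = D 2"
    using ucs_M[OF assms, of "c - 2" u] u c3 Suc_diff_Suc[of 2 c] by (simp del: ucs.simps)
  ultimately show False
    using D_strict[OF cls, of 1] c3 by (simp add: numeral_2_eq_2)
qed

text \<open>In class 2, \<open>D 1\<close> is central, so all products in the plane
  \<open>M u\<close> are multiples of \<open>br u u\<close>.\<close>

lemma ucs_M_1:
  assumes u: "u \<notin> D 1" and c: "c = 2"
  shows "dim (ucs (M u) 1) = 2 \<longleftrightarrow> br u u = 0"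
proof -
  have cen: "br a b = 0" "br b a = 0" if "b \<in> D 1" for a b
    using br_D_Suc[of b 1 a] br_D_right[of b 1 a] that D_c c by (auto simp: numeral_2_eq_2)
  have uM: "u \<in> M u" by (simp add: span_base)
  have dM: "dim (M u) = 2" using dim_M[OF u] c by simp
  have "ucs (M u) 1 \<subseteq> M u" by (rule ucs_subset) simp
  then have "dim (ucs (M u) 1) = 2 \<longleftrightarrow> ucs (M u) 1 = M u"
    by (metis dM order_refl subspace_dim_equal subspace_span subspace_ucs)
  also have "\<dots> \<longleftrightarrow> br u u = 0"
  proof
    assume "ucs (M u) 1 = M u"
    with uM have "u \<in> ucs (M u) 1" by simp
    then show "br u u = 0" using uM by simp
  next
    assume uu: "br u u = 0"
    have "br m n = 0" if mn: "m \<in> M u" "n \<in> M u" for m n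
    proof -
      obtain k w where "w \<in> D 1" "m = scale k u + w" using mn(1) by (rule M_cases)
      moreover obtain l w' where "w' \<in> D 1" "n = scale l u + w'" using mn(2) by (rule M_cases)
      ultimately show ?thesis by (simp add: br_linear cen uu)
    qed
    then show "ucs (M u) 1 = M u" by auto
  qed
  finally show ?thesis .
qed

lemma basis3I:
  assumes "c = 2" "z \<noteq> 0" "x \<notin> span {z}" "y \<notin> span {x, z}"
  shows "basis3 x y z"
proof -
  have "{x, y, z} = insert y {x, z}" by auto
  moreover have ind: "independent (insert y {x, z})"
    using assms by (auto simp: independent_insert)
  moreover have dist: "distinct [x, y, z]"
    using assms by (auto simp: span_base)
  moreover have "UNIV \<subseteq> span (insert y {x, z})"
  proof (rule card_ge_dim_independent[OF _ ind])
    have "card (insert y {x, z}) = 3" using dist by auto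
    then show "dim UNIV \<le> card (insert y {x, z})" using dim_carrier assms(1) by simp
  qed simp
  ultimately show ?thesis by (auto simp: basis3_def)
qed

text \<open>The polynomial is the coefficient of \<open>z\<close> in the square of
  \<open>y - scale t x\<close>; having no root records anisotropy in every characteristic.\<close>

lemma class_2_cases:
  assumes P2 and c: "c = 2"
  shows "Heisenberg3 \<or>
    (\<exists>x y z \<tau> lam eps. basis3 x y z \<and>
       br x x = z \<and> br y y = scale \<tau> z \<and>
       br x y = scale lam z \<and> br y x = scale eps z \<and>
       br x z = 0 \<and> br z x = 0 \<and> br y z = 0 \<and> br z y = 0 \<and> br z z = 0 \<and>
       (\<forall>t. t\<^sup>2 - (lam + eps) * t + \<tau> \<noteq> 0))"
proof -
  have cen: "br a b = 0" "br b a = 0" if "b \<in> D 1" for a b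
    using br_D_Suc[of b 1 a] br_D_right[of b 1 a] that D_c c by (auto simp: numeral_2_eq_2)
  have D1: "br a b \<in> D 1" for a b using br_D_Suc[of b 0 a] by simp
  have D1_span: "D 1 = span {z}" if "z \<in> D 1" "z \<noteq> 0" for z
    using D_eq_span[of 1 z] that c D_c by (simp add: numeral_2_eq_2 insert_commute)
  have all: "br u u = 0 \<longleftrightarrow> br v v = 0" if "u \<notin> D 1" "v \<notin> D 1" for u v
    using ucs_M_1[OF that(1) c] ucs_M_1[OF that(2) c] \<open>P2\<close> M_maximal[OF that(1)] M_maximal[OF that(2)]
    unfolding P2_def by metis
  obtain x where x: "x \<notin> D 1" using D_strict[OF cls, of 0] c by auto
  show ?thesis
  proof (cases "br x x = 0")
    case True
    then have Lie: "br a a = 0" for a using all[OF x, of a] cen by blast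
    obtain x y where xy: "br x y \<noteq> 0"
    proof -
      have "\<not> D (Suc 0) \<subseteq> {0}" using D_strict[OF cls, of 1] c D_c by (auto simp: numeral_2_eq_2)
      then show ?thesis using D_Suc_subset[of "{0}" 0] that by auto
    qed
    let ?z = "br x y"
    note z = D1_span[OF D1 xy]
    have "x \<notin> span {?z}" using cen(2)[of x y] xy z by blast
    \<comment> \<open>Otherwise \<open>y\<close> is a multiple of \<open>x\<close> modulo the
      central \<open>D 1\<close>, which makes \<open>br x y\<close> a multiple of
      \<open>br x x\<close>, that is, zero.\<close>
    moreover have "y \<notin> span {x, ?z}"
    proof
      assume "y \<in> span {x, ?z}"
      then obtain k where "y - scale k x \<in> span {?z}" by (auto simp: span_breakdown_eq[of _ x])
      then have "br x (y - scale k x) = 0" using cen z by blast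
      then show False using xy by (simp add: br_diff_right br_scale_right Lie)
    qed
    ultimately have "basis3 x y ?z" using basis3I[OF c xy] by blast
    then show ?thesis using Lie cen D1 by (auto simp: Heisenberg3_def is_Lie_def)
  next
    case False
    then have sq: "br a a \<noteq> 0" if "a \<notin> D 1" for a using all[OF x that] by simp
    let ?z = "br x x"
    note z = D1_span[OF D1 False]
    obtain y where y: "y \<notin> M x" using M_neq_UNIV[OF x] by blast
    have Mx: "span {x, ?z} \<subseteq> M x"
      using z D1 by (intro span_mono) auto
    have "basis3 x y ?z" using basis3I[OF c False] x y Mx z by blast
    moreover have sc: "\<exists>k. br a b = scale k ?z" for a b
      using D1[of a b] z by (auto simp: span_singleton)
    from sc[of y y] sc[of x y] sc[of y x]
    obtain \<tau> lam eps where p: "br y y = scale \<tau> ?z" "br x y = scale lam ?z" "br y x = scale eps ?z"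
      by blast
    moreover have "t\<^sup>2 - (lam + eps) * t + \<tau> \<noteq> 0" for t
    proof
      assume *: "t\<^sup>2 - (lam + eps) * t + \<tau> = 0"
      let ?w = "y - scale t x"
      have "?w \<notin> D 1" using y by (auto simp: span_breakdown_eq)
      then have "br ?w ?w \<noteq> 0" by (rule sq)
      moreover have "br ?w ?w = scale (t\<^sup>2 - (lam + eps) * t + \<tau>) ?z"
        by (simp add: br_diff_left br_diff_right br_scale_left br_scale_right p
            power2_eq_square scale_left_distrib scale_left_diff_distrib algebra_simps)
      ultimately show False using * by simp
    qed
    ultimately show ?thesis using cen D1 by metis
  qed
qed

end

end

section \<open>Discriminants and the classification\<close>

lemma quadratic_root_of_discriminant:
  fixes p q s :: "'f::field"
  assumes "(2::'f) \<noteq> 0" "p\<^sup>2 - 4 * q = s\<^sup>2"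
  shows "((p + s) / 2)\<^sup>2 - p * ((p + s) / 2) + q = 0"
proof -
  define h where "h = (p + s) / 2"
  have "2 * h = p + s"
    unfolding h_def by (simp only: times_divide_eq_right nonzero_mult_div_cancel_left[OF assms(1)])
  then have p: "p = 2 * h - s" by simp
  \<comment> \<open>Substituting for \<open>p\<close> leaves a factor 4, written as
    \<open>2 * 2\<close> so that the hypothesis on 2 cancels it.\<close>
  have "2 * (2 * (h\<^sup>2 - h * s - q)) = 0"
    using assms(2) unfolding p by (simp add: power2_eq_square algebra_simps)
  then have "h\<^sup>2 - h * s - q = 0" using assms(1) by (simp only: mult_eq_0_iff simp_thms)
  then have q: "q = h\<^sup>2 - h * s" by simp
  show ?thesis
    unfolding h_def[symmetric] unfolding p q by (simp add: power2_eq_square algebra_simps)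
qed

text \<open>In characteristic 2 the discriminant is the square of \<open>lam + eps\<close>, so
  anisotropy is expressed there by the quadratic having no root.\<close>

theorem theorem3p5:
  fixes scale :: "'f::field \<Rightarrow> 'a::ab_group_add \<Rightarrow> 'a"
    and br :: "'a \<Rightarrow> 'a \<Rightarrow> 'a"
  assumes "leibniz_algebra scale br"
    and "\<exists>B. finite_dimensional_vector_space scale B"
    and "leibniz_algebra.nilpotent scale br"
    and "leibniz_algebra.P2 scale br"
    and "leibniz_algebra.cc scale br = 1"
  shows "(leibniz_algebra.is_Lie br \<and>
            (leibniz_algebra.abelian br \<and> vector_space.dim scale (UNIV :: 'a set) = 2 \<or>
             leibniz_algebra.Heisenberg3 scale br)) \<or>
         (leibniz_algebra.ucs br UNIV 2 = UNIV \<and>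
          vector_space.dim scale (UNIV :: 'a set) = 3 \<and>
          (\<exists>x y z \<tau> lam eps. leibniz_algebra.basis3 scale x y z \<and>
             br x x = z \<and> br y y = scale \<tau> z \<and>
             br x y = scale lam z \<and> br y x = scale eps z \<and>
             br x z = 0 \<and> br z x = 0 \<and> br y z = 0 \<and> br z y = 0 \<and> br z z = 0 \<and>
             \<tau> \<noteq> 0 \<and>
             ((2::'f) \<noteq> 0 \<longrightarrow> \<not> (\<exists>s. (lam + eps)\<^sup>2 - 4 * \<tau> = s\<^sup>2)) \<and>
             ((2::'f) = 0 \<longrightarrow> \<not> (\<exists>t. t\<^sup>2 - (lam + eps) * t + \<tau> = 0))))"
proof -
  obtain B where B: "finite_dimensional_vector_space scale B" using assms(2) ..
  interpret fd_leibniz_algebra scale br B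
    using assms(1) B by (rule fd_leibniz_algebra.intro)
  have "(UNIV :: 'a set) \<noteq> {0}"
  \<comment> \<open>Dimension 0 would make the coclass \<open>- int cl\<close>, which is at most
    0.\<close>
  proof
    assume "(UNIV :: 'a set) = {0}"
    then have "dim (UNIV :: 'a set) = 0" by (simp add: dim_eq_0)
    then show False using assms(5) unfolding cc_def by linarith
  qed
  then have cls: "nilpotent_of_class cl" by (rule nilpotent_of_class_cl[OF assms(3)])
  have dim: "dim (UNIV :: 'a set) = cl + 1" using assms(5) by (simp add: cc_def)
  note c = c_pos[OF cls dim] D_c[OF cls dim] class_le_2[OF cls dim assms(4)]
  consider "cl = 1" | "cl = 2" using c by linarith
  then show ?thesis
  proof cases
    case 1
    then have "br a b = 0" for a b using br_D_Suc[of b 0 a] c(2) by simp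
    then show ?thesis using dim 1 by (simp add: is_Lie_def abelian_def)
  next
    case 2
    have "br a b \<in> D 1" for a b using br_D_Suc[of b 0 a] by simp
    then have "br (br a b) m = 0" "br m (br a b) = 0" for a b m
      using br_D_Suc[of "br a b" 1 m] br_D_right[of "br a b" 1 m] c(2) 2
      by (auto simp: numeral_2_eq_2)
    then have ucs: "ucs UNIV 2 = UNIV" by (simp add: numeral_2_eq_2)
    from class_2_cases[OF cls dim assms(4) 2] show ?thesis
    proof (elim disjE exE conjE)
      assume "Heisenberg3"
      then show ?thesis by (simp add: Heisenberg3_def)
    next
      fix x y z \<tau> lam eps
      assume *: "basis3 x y z" "br x x = z" "br y y = scale \<tau> z"
        "br x y = scale lam z" "br y x = scale eps z"
        "br x z = 0" "br z x = 0" "br y z = 0" "br z y = 0" "br z z = 0"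
        and root: "\<forall>t. t\<^sup>2 - (lam + eps) * t + \<tau> \<noteq> 0"
      have \<tau>: "\<tau> \<noteq> 0" using root[rule_format, of 0] by simp
      have disc: "\<nexists>s. (lam + eps)\<^sup>2 - 4 * \<tau> = s\<^sup>2" if "(2::'f) \<noteq> 0"
        using root quadratic_root_of_discriminant[OF that] by blast
      show ?thesis
        by (intro disjI2 conjI, rule ucs, use dim 2 in simp, rule exI[of _ x], rule exI[of _ y],
            rule exI[of _ z], rule exI[of _ \<tau>], rule exI[of _ lam], rule exI[of _ eps])
          (use * \<tau> disc root in blast)
    qed
  qed
qed

end
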